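(* Let $A_2\in\mathbf{C}^{n\times n}$, $B_2\in\mathbf{C}^{n\times m}$, and let $Q\in\mathbf{C}^{n\times n}$, $R\in\mathbf{C}^{m\times m}$ be positive definite (Hermitian). Put $$Q_0=Q^{-1}+\left(A_2Q^{-1}A_2^{\mathrm H}\right)^{\#}+\left(B_2R^{-1}B_2^{\mathrm H}\right)^{\#}>0.$$ If the anti-Riccati equation $$-Q=A_2^{\mathrm H}P_A^{\#}A_2-A_2^{\mathrm H}P_A^{\#}B_2\left(R+B_2^{\mathrm H}P_A^{\#}B_2\right)^{-1}B_2^{\mathrm H}P_A^{\#}A_2-P_A$$ has a positive definite solution $P_A$, then the nonlinear matrix equation $$X+A^{\mathrm H}X^{-\#}A=I_n\qquad\text{with}\qquad A=Q_0^{-\frac{\#}{2}}A_2Q^{-1}Q_0^{-\frac12}$$ also has a positive definite solution $X$ such that $$X=Q_0^{-\frac12}\left(P_A^{-1}+\left(A_2Q^{-1}A_2^{\mathrm H}\right)^{\#}+\left(B_2R^{-1}B_2^{\mathrm H}\right)^{\#}\right)Q_0^{-\frac12}.$$ Moreover, if the antilinear system $x(k+1)=A_2^{\#}x^{\#}(k)+B_2^{\#}u^{\#}(k)$ is stabilizable, then the matrix $X$ given by this formula is the maximal solution of $X+A^{\mathrm H}X^{-\#}A=I_n$.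
   Context: For a complex matrix $M$, $M^{\#}$, $M^{\mathrm T}$, $M^{\mathrm H}$ denote its (entrywise) conjugate, transpose and conjugate transpose, and $M^{-\#}=(M^{-1})^{\#}=(M^{\#})^{-1}$. Positive definite matrices are Hermitian; $Q_0^{-1/2}$ is the inverse of the positive definite square root of $Q_0$, and $Q_0^{-\#/2}=(Q_0^{-1/2})^{\#}$. Matrix inequalities are in the Loewner order; the maximal solution of $X+A^{\mathrm H}X^{-\#}A=I_n$ is the positive definite solution $X$ such that $X\ge Y$ for every positive definite solution $Y$. The antilinear system is stabilizable if there exist $K_1,K_2\in\mathbf{C}^{m\times n}$ such that the feedback $u(k)=K_1x(k)+K_2^{\#}x^{\#}(k)$ makes the closed-loop system asymptotically stable; equivalently (a known fact), $\mathrm{rank}\begin{bmatrix}\lambda I_n-A_2A_2^{\#}&B_2&A_2B_2^{\#}\end{bmatrix}=n$ for all $\lambda\in\mathbf{C}$ with $|\lambda|\ge1$. *)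

theory Defs
  imports "HOL-Analysis.Analysis"
begin

definition vec_cnj :: "complex ^ 'n \<Rightarrow> complex ^ 'n" where
  "vec_cnj x = (\<chi> i. cnj (x $ i))"

definition mat_cnj :: "complex ^ 'n ^ 'm \<Rightarrow> complex ^ 'n ^ 'm" where
  "mat_cnj M = map_matrix cnj M"

definition mat_adj :: "complex ^ 'n ^ 'm \<Rightarrow> complex ^ 'm ^ 'n" where
  "mat_adj M = transpose (mat_cnj M)"

definition hermitian :: "complex ^ 'n ^ 'n \<Rightarrow> bool" where
  "hermitian M \<longleftrightarrow> mat_adj M = M"

text \<open>The value of \<open>x\<^sup>H M x\<close>; it is real whenever \<open>M\<close> is Hermitian.\<close>

definition quad_form :: "complex ^ 'n ^ 'n \<Rightarrow> complex ^ 'n \<Rightarrow> complex" where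
  "quad_form M x = (\<Sum>i\<in>UNIV. cnj (x $ i) * (M *v x) $ i)"

definition pos_semidef :: "complex ^ 'n ^ 'n \<Rightarrow> bool" where
  "pos_semidef M \<longleftrightarrow> hermitian M \<and> (\<forall>x. 0 \<le> Re (quad_form M x))"

definition pos_def :: "complex ^ 'n ^ 'n \<Rightarrow> bool" where
  "pos_def M \<longleftrightarrow> hermitian M \<and> (\<forall>x. x \<noteq> 0 \<longrightarrow> 0 < Re (quad_form M x))"

definition loewner_le :: "complex ^ 'n ^ 'n \<Rightarrow> complex ^ 'n ^ 'n \<Rightarrow> bool" where
  "loewner_le Y X \<longleftrightarrow> pos_semidef (X - Y)"

text \<open>Only meaningful for positive definite \<open>M\<close>, which has exactly one positive definite
  square root.\<close>

definition pd_sqrt :: "complex ^ 'n ^ 'n \<Rightarrow> complex ^ 'n ^ 'n" where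
  "pd_sqrt M = (THE S. pos_def S \<and> S ** S = M)"

definition pd_inv_sqrt :: "complex ^ 'n ^ 'n \<Rightarrow> complex ^ 'n ^ 'n" where
  "pd_inv_sqrt M = matrix_inv (pd_sqrt M)"

text \<open>Positive definite solutions \<open>X\<close> of \<open>X + A\<^sup>H X\<^sup>-\<^sup># A = I\<close>.\<close>

definition nme_pd_solution :: "complex ^ 'n ^ 'n \<Rightarrow> complex ^ 'n ^ 'n \<Rightarrow> bool" where
  "nme_pd_solution A X \<longleftrightarrow>
     pos_def X \<and> X + mat_adj A ** mat_cnj (matrix_inv X) ** A = mat 1"

definition nme_maximal_solution :: "complex ^ 'n ^ 'n \<Rightarrow> complex ^ 'n ^ 'n \<Rightarrow> bool" where
  "nme_maximal_solution A X \<longleftrightarrow>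
     nme_pd_solution A X \<and> (\<forall>Y. nme_pd_solution A Y \<longrightarrow> loewner_le Y X)"

definition anti_riccati ::
  "complex ^ 'n ^ 'n \<Rightarrow> complex ^ 'm ^ 'n \<Rightarrow> complex ^ 'n ^ 'n \<Rightarrow> complex ^ 'm ^ 'm
    \<Rightarrow> complex ^ 'n ^ 'n \<Rightarrow> bool" where
  "anti_riccati A B Q R P \<longleftrightarrow>
     - Q = mat_adj A ** mat_cnj P ** A
           - mat_adj A ** mat_cnj P ** B
               ** matrix_inv (R + mat_adj B ** mat_cnj P ** B)
               ** mat_adj B ** mat_cnj P ** A
           - P"

text \<open>One step \<open>x(k+1) = A\<^sup># x\<^sup>#(k) + B\<^sup># u\<^sup>#(k)\<close> of the antilinear system.\<close>

definition antilinear_step ::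
  "complex ^ 'n ^ 'n \<Rightarrow> complex ^ 'm ^ 'n \<Rightarrow> complex ^ 'n \<Rightarrow> complex ^ 'm \<Rightarrow> complex ^ 'n" where
  "antilinear_step A B x u = mat_cnj A *v vec_cnj x + mat_cnj B *v vec_cnj u"

text \<open>Lyapunov stability together with global attractivity of the origin, for the autonomous
  system \<open>x(k+1) = f (x(k))\<close>.\<close>

definition asymptotically_stable :: "(complex ^ 'n \<Rightarrow> complex ^ 'n) \<Rightarrow> bool" where
  "asymptotically_stable f \<longleftrightarrow>
     (\<forall>\<epsilon>>0. \<exists>\<delta>>0. \<forall>x. (\<forall>k. x (Suc k) = f (x k)) \<and> norm (x 0) < \<delta>
         \<longrightarrow> (\<forall>k. norm (x k) < \<epsilon>)) \<and>
     (\<forall>x. (\<forall>k. x (Suc k) = f (x k)) \<longrightarrow> x \<longlonglongrightarrow> 0)"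

definition stabilizable :: "complex ^ 'n ^ 'n \<Rightarrow> complex ^ 'm ^ 'n \<Rightarrow> bool" where
  "stabilizable A B \<longleftrightarrow>
     (\<exists>(K1 :: complex ^ 'n ^ 'm) (K2 :: complex ^ 'n ^ 'm).
        asymptotically_stable
          (\<lambda>x. antilinear_step A B x (K1 *v x + mat_cnj K2 *v vec_cnj x)))"

end

theory Submission
  imports Defs
begin

text \<open>Write \<open>G = B\<^sub>2 R\<^sup>-\<^sup>1 B\<^sub>2\<^sup>H\<close>, \<open>K = P\<^sup>-\<^sup># + G\<close>, \<open>L = A\<^sub>2 Q\<^sup>-\<^sup>1\<close> and let \<open>W\<close> be the middle
  factor of \<open>X\<close>, so that \<open>W\<^sup># = K + A\<^sub>2 Q\<^sup>-\<^sup>1 A\<^sub>2\<^sup>H\<close>. The Woodbury identity turns the anti-Riccati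
  equation into \<open>P = Q + A\<^sub>2\<^sup>H K\<^sup>-\<^sup>1 A\<^sub>2\<close>, and a second time into
  \<open>P\<^sup>-\<^sup>1 = Q\<^sup>-\<^sup>1 - L\<^sup>H W\<^sup>-\<^sup># L\<close>, that is \<open>W + L\<^sup>H W\<^sup>-\<^sup># L = Q\<^sub>0\<close>; congruence by
  \<open>Q\<^sub>0\<^sup>-\<^sup>1\<^sup>/\<^sup>2\<close> gives the nonlinear equation.

  If \<open>Y\<close> is another solution, \<open>D = X - Y\<close> and \<open>T = X\<^sup>-\<^sup># A\<close>, then \<open>D \<ge> T\<^sup>H D\<^sup># T\<close>. The matrix
  \<open>M = Q\<^sub>0\<^sup>-\<^sup>1\<^sup>/\<^sup>2 P\<^sup>-\<^sup>1 Q\<^sub>0\<^sup>-\<^sup>1\<^sup>/\<^sup>2\<close> satisfies \<open>M > T\<^sup>H M\<^sup># T\<close>, so \<open>T\<close> is an antilinear contraction,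
  and \<open>D \<ge> 0\<close> follows.\<close>

section \<open>Conjugates, adjoints and inverses\<close>

lemma mat_adj_nth [simp]: "mat_adj M $ i $ j = cnj (M $ j $ i)"
  by (simp add: mat_adj_def mat_cnj_def transpose_def map_matrix_def)

lemma mat_cnj_nth [simp]: "mat_cnj M $ i $ j = cnj (M $ i $ j)"
  by (simp add: mat_cnj_def map_matrix_def)

lemma vec_cnj_nth [simp]: "vec_cnj x $ i = cnj (x $ i)"
  by (simp add: vec_cnj_def)

lemma mat_adj_mat_adj [simp]: "mat_adj (mat_adj M) = M"
  by (simp add: vec_eq_iff)

lemma mat_cnj_mat_cnj [simp]: "mat_cnj (mat_cnj M) = M"
  by (simp add: vec_eq_iff)

lemma vec_cnj_vec_cnj [simp]: "vec_cnj (vec_cnj x) = x"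
  by (simp add: vec_eq_iff)

lemma vec_cnj_eq_0_iff [simp]: "vec_cnj x = 0 \<longleftrightarrow> x = 0"
  by (simp add: vec_eq_iff)

lemma mat_adj_mat_cnj: "mat_adj (mat_cnj M) = mat_cnj (mat_adj M)"
  by (simp add: vec_eq_iff)

lemma mat_adj_mat_1 [simp]: "mat_adj (mat 1) = mat 1"
  by (simp add: vec_eq_iff mat_def)

lemma mat_cnj_mat_1 [simp]: "mat_cnj (mat 1) = mat 1"
  by (simp add: vec_eq_iff mat_def)

lemma mat_adj_add: "mat_adj (M + N) = mat_adj M + mat_adj N"
  by (simp add: vec_eq_iff)

lemma mat_adj_diff: "mat_adj (M - N) = mat_adj M - mat_adj N"
  by (simp add: vec_eq_iff)

lemma mat_adj_scaleR: "mat_adj (r *\<^sub>R M) = r *\<^sub>R mat_adj M"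
  by (simp add: vec_eq_iff)

lemma mat_cnj_add: "mat_cnj (M + N) = mat_cnj M + mat_cnj N"
  by (simp add: vec_eq_iff)

lemma mat_cnj_diff: "mat_cnj (M - N) = mat_cnj M - mat_cnj N"
  by (simp add: vec_eq_iff)

lemma mat_adj_mult: "mat_adj (M ** N) = mat_adj N ** mat_adj M"
  by (simp add: vec_eq_iff matrix_matrix_mult_def mult.commute)

lemma mat_cnj_mult: "mat_cnj (M ** N) = mat_cnj M ** mat_cnj N"
  by (simp add: vec_eq_iff matrix_matrix_mult_def)

lemma vec_cnj_mult: "vec_cnj (M *v x) = mat_cnj M *v vec_cnj x"
  by (simp add: vec_eq_iff matrix_vector_mult_def)

lemma matrix_add_rdistrib: "(A + B) ** C = A ** C + B ** C"
  by (simp add: vec_eq_iff matrix_matrix_mult_def distrib_right sum.distrib)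

lemma matrix_sub_ldistrib: "A ** (B - C) = A ** B - A ** C"
  for A :: "'a::ring_1 ^ 'n ^ 'm"
  by (simp add: vec_eq_iff matrix_matrix_mult_def right_diff_distrib sum_subtractf)

lemma matrix_sub_rdistrib: "(A - B) ** C = A ** C - B ** C"
  for A :: "'a::ring_1 ^ 'n ^ 'm"
  by (simp add: vec_eq_iff matrix_matrix_mult_def left_diff_distrib sum_subtractf)

lemmas matrix_distribs =
  matrix_add_ldistrib matrix_add_rdistrib matrix_sub_ldistrib matrix_sub_rdistrib

lemma matrix_vector_mult_scaleR_gen: "A *v (r *\<^sub>R x) = r *\<^sub>R (A *v x)"
  for A :: "'a::real_algebra_1 ^ 'n ^ 'm"
  by (simp add: vec_eq_iff matrix_vector_mult_def scaleR_sum_right)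

lemma scaleR_matrix_vector_gen: "(r *\<^sub>R A) *v x = r *\<^sub>R (A *v x)"
  for A :: "'a::real_algebra_1 ^ 'n ^ 'm"
  by (simp add: vec_eq_iff matrix_vector_mult_def scaleR_sum_right)

lemma matrix_vector_mult_axis: "(A *v axis j 1) $ i = A $ i $ j"
  for A :: "'a::semiring_1 ^ 'n ^ 'm"
  by (simp add: matrix_vector_mult_def axis_def if_distrib cong: if_cong)

section \<open>Inverses of square matrices and the Woodbury identity\<close>

lemma matrix_inv_right: "M ** matrix_inv M = mat 1"
  and matrix_inv_left: "matrix_inv M ** M = mat 1" if "invertible M"
  using that unfolding invertible_def matrix_inv_def by (auto dest!: someI_ex)

text \<open>A right inverse of a square matrix over a field is also a left inverse, so one product
  identifies the inverse.\<close>

lemma matrix_inv_unique: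
  fixes M N :: "'a::field ^ 'n ^ 'n"
  assumes "M ** N = mat 1"
  shows "matrix_inv M = N" "invertible M"
proof -
  have N: "N ** M = mat 1"
    using assms matrix_left_right_inverse by blast
  show inv: "invertible M"
    using assms N unfolding invertible_def by blast
  have "matrix_inv M = matrix_inv M ** (M ** N)"
    using assms by simp
  also have "\<dots> = N"
    by (simp only: matrix_mul_assoc matrix_inv_left[OF inv] matrix_mul_lid)
  finally show "matrix_inv M = N" .
qed

text \<open>The leading factor \<open>N\<close> lets the cancellation apply inside products that
  \<open>matrix_mul_assoc\<close> brackets to the left.\<close>

lemma matrix_inv_cancel:
  fixes M :: "'a::field ^ 'n ^ 'n" and N :: "'a ^ 'n ^ 'm"
  assumes "invertible M"
  shows "N ** M ** matrix_inv M = N" "N ** matrix_inv M ** M = N"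
  using assms
  by (simp_all add: matrix_mul_assoc [symmetric] matrix_inv_left matrix_inv_right)

lemma matrix_inv_mat_cnj:
  fixes M :: "complex ^ 'n ^ 'n"
  assumes "invertible M"
  shows "matrix_inv (mat_cnj M) = mat_cnj (matrix_inv M)" "invertible (mat_cnj M)"
proof -
  have "mat_cnj M ** mat_cnj (matrix_inv M) = mat 1"
    by (simp add: mat_cnj_mult [symmetric] matrix_inv_right assms)
  then show "matrix_inv (mat_cnj M) = mat_cnj (matrix_inv M)" "invertible (mat_cnj M)"
    by (auto intro: matrix_inv_unique)
qed

lemma mat_adj_matrix_inv:
  fixes M :: "complex ^ 'n ^ 'n"
  assumes "invertible M"
  shows "mat_adj (matrix_inv M) = matrix_inv (mat_adj M)"
proof -
  have "mat_adj M ** mat_adj (matrix_inv M) = mat 1"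
    by (simp add: mat_adj_mult [symmetric] matrix_inv_left assms)
  then show ?thesis
    by (metis matrix_inv_unique(1))
qed

lemma matrix_inv_mult:
  fixes M N :: "'a::field ^ 'n ^ 'n"
  assumes "invertible M" "invertible N"
  shows "matrix_inv (M ** N) = matrix_inv N ** matrix_inv M"
  by (rule matrix_inv_unique)
    (simp add: matrix_mul_assoc matrix_inv_cancel assms matrix_inv_right)

lemma matrix_inv_invertible:
  fixes M :: "'a::field ^ 'n ^ 'n"
  assumes "invertible M"
  shows "invertible (matrix_inv M)" "matrix_inv (matrix_inv M) = M"
  using matrix_inv_unique [OF matrix_inv_left [OF assms]] by auto

text \<open>With \<open>U = R + C M B\<close> one has \<open>C M B = U - R\<close>, hence
  \<open>R^-1 C M B U^-1 = R^-1 - U^-1\<close>, and the cross terms cancel. The product form feeds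
  \<open>matrix_inv_unique\<close>.\<close>

lemma woodbury:
  fixes M :: "'a::field ^ 'n ^ 'n" and R :: "'a ^ 'm ^ 'm"
    and B :: "'a ^ 'm ^ 'n" and C :: "'a ^ 'n ^ 'm"
  assumes M: "invertible M" and R: "invertible R" and U: "invertible (R + C ** M ** B)"
  shows "(matrix_inv M + B ** matrix_inv R ** C)
    ** (M - M ** B ** matrix_inv (R + C ** M ** B) ** C ** M) = mat 1"
proof -
  define U where "U = R + C ** M ** B"
  have CMB: "C ** M ** B = U - R"
    by (simp add: U_def)
  have "matrix_inv R ** C ** M ** B ** matrix_inv U = matrix_inv R ** (C ** M ** B) ** matrix_inv U"
    by (simp add: matrix_mul_assoc)
  also have "\<dots> = matrix_inv R - matrix_inv U"
    using U unfolding CMB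
    by (simp add: matrix_distribs matrix_inv_cancel R matrix_inv_left U_def [symmetric])
  finally have "B ** (matrix_inv R ** C ** M ** B ** matrix_inv U) ** C ** M
      = B ** (matrix_inv R - matrix_inv U) ** C ** M"
    by simp
  then have key: "B ** matrix_inv R ** C ** M ** B ** matrix_inv U ** C ** M
      = B ** (matrix_inv R - matrix_inv U) ** C ** M"
    by (simp only: matrix_mul_assoc)
  show ?thesis
    unfolding U_def [symmetric]
    by (simp add: matrix_distribs matrix_mul_assoc key M matrix_inv_left)
qed

section \<open>Definite matrices\<close>

text \<open>The real inner product is the real part of the Hermitian one, so definiteness can be
  treated in a real Euclidean space.\<close>

lemma inner_complex_vec: "inner x (y :: complex ^ 'n) = Re (\<Sum>i\<in>UNIV. cnj (x $ i) * y $ i)"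
  by (simp add: inner_vec_def inner_complex_def)

lemma Re_quad_form: "Re (quad_form M x) = inner x (M *v x)"
  by (simp add: quad_form_def inner_complex_vec)

lemma inner_mat_adj: "inner (mat_adj M *v x) y = inner x (M *v y)"
proof -
  have "(\<Sum>i\<in>UNIV. cnj ((mat_adj M *v x) $ i) * y $ i)
      = (\<Sum>i\<in>UNIV. \<Sum>j\<in>UNIV. M $ j $ i * cnj (x $ j) * y $ i)"
    by (simp add: matrix_vector_mult_def sum_distrib_right)
  also have "\<dots> = (\<Sum>j\<in>UNIV. \<Sum>i\<in>UNIV. M $ j $ i * cnj (x $ j) * y $ i)"
    by (rule sum.swap)
  also have "\<dots> = (\<Sum>j\<in>UNIV. cnj (x $ j) * (M *v y) $ j)"
    by (simp add: matrix_vector_mult_def sum_distrib_left mult_ac)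
  finally show ?thesis
    by (simp add: inner_complex_vec)
qed

lemma inner_vec_cnj: "inner (vec_cnj x) (vec_cnj y) = inner x y"
  by (simp add: inner_vec_def inner_complex_def)

lemma pos_def_adj: "pos_def M \<Longrightarrow> mat_adj M = M"
  by (simp add: pos_def_def hermitian_def)

lemma pos_semidef_adj: "pos_semidef M \<Longrightarrow> mat_adj M = M"
  by (simp add: pos_semidef_def hermitian_def)

lemma pos_def_inner: "pos_def M \<Longrightarrow> x \<noteq> 0 \<Longrightarrow> 0 < inner x (M *v x)"
  by (simp add: pos_def_def Re_quad_form)

lemma pos_semidef_inner: "pos_semidef M \<Longrightarrow> 0 \<le> inner x (M *v x)"
  by (simp add: pos_semidef_def Re_quad_form)

lemma pos_defI: "mat_adj M = M \<Longrightarrow> (\<And>x. x \<noteq> 0 \<Longrightarrow> 0 < inner x (M *v x)) \<Longrightarrow> pos_def M"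
  by (simp add: pos_def_def Re_quad_form hermitian_def)

lemma pos_semidefI: "mat_adj M = M \<Longrightarrow> (\<And>x. 0 \<le> inner x (M *v x)) \<Longrightarrow> pos_semidef M"
  by (simp add: pos_semidef_def Re_quad_form hermitian_def)

lemma pos_def_imp_semidef:
  assumes "pos_def M"
  shows "pos_semidef M"
proof (rule pos_semidefI)
  show "0 \<le> inner x (M *v x)" for x
    using pos_def_inner [OF assms, of x] by (cases "x = 0") auto
qed (rule pos_def_adj [OF assms])

lemma pos_def_add_semidef: "pos_def M \<Longrightarrow> pos_semidef N \<Longrightarrow> pos_def (M + N)"
  by (intro pos_defI)
    (simp_all add: mat_adj_add pos_def_adj pos_semidef_adj matrix_vector_mult_add_rdistrib
      inner_add_right add_pos_nonneg pos_def_inner pos_semidef_inner)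

lemma inner_congruence: "inner x ((mat_adj T ** M ** T) *v x) = inner (T *v x) (M *v (T *v x))"
  using inner_mat_adj [of "mat_adj T" x "M *v (T *v x)"]
  by (simp add: matrix_vector_mul_assoc matrix_mul_assoc)

lemma pos_semidef_congruence: "pos_semidef M \<Longrightarrow> pos_semidef (mat_adj T ** M ** T)"
  by (rule pos_semidefI)
    (simp_all add: inner_congruence mat_adj_mult matrix_mul_assoc pos_semidef_adj pos_semidef_inner)

lemma invertible_mult_eq_0:
  fixes T :: "'a::field ^ 'n ^ 'n"
  assumes "invertible T" "T *v x = 0"
  shows "x = 0"
proof -
  have "x = matrix_inv T *v (T *v x)"
    by (simp add: matrix_vector_mul_assoc matrix_inv_left assms(1))
  then show ?thesis
    by (simp add: assms(2))
qed

lemma pos_def_congruence: "pos_def M \<Longrightarrow> invertible T \<Longrightarrow> pos_def (mat_adj T ** M ** T)"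
  for M T :: "complex ^ 'n ^ 'n"
  using invertible_mult_eq_0 [of T]
  by (intro pos_defI)
    (auto simp: inner_congruence mat_adj_mult matrix_mul_assoc pos_def_adj intro!: pos_def_inner)

lemma pos_def_invertible:
  assumes "pos_def M"
  shows "invertible M"
proof -
  have "x = 0" if "M *v x = 0" for x
    using pos_def_inner [OF assms, of x] that by fastforce
  then show ?thesis
    by (metis invertible_left_inverse matrix_left_invertible_ker)
qed

text \<open>The inverse is Hermitian, so \<open>M^-1 = M^-H M M^-1\<close> is a congruence of
  \<open>M\<close>.\<close>

lemma pos_def_matrix_inv:
  assumes "pos_def M"
  shows "pos_def (matrix_inv M)"
proof -
  note inv = pos_def_invertible [OF assms]
  have "mat_adj (matrix_inv M) = matrix_inv M"
    by (simp add: mat_adj_matrix_inv inv pos_def_adj assms)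
  moreover have "pos_def (mat_adj (matrix_inv M) ** M ** matrix_inv M)"
    by (intro pos_def_congruence assms matrix_inv_invertible inv)
  ultimately show ?thesis
    by (simp add: matrix_inv_left inv)
qed

text \<open>Conjugating the matrix amounts to conjugating the vector, so definiteness passes to
  \<open>mat_cnj M\<close>.\<close>

lemma inner_mat_cnj: "inner x (mat_cnj M *v x) = inner (vec_cnj x) (M *v vec_cnj x)"
  using inner_vec_cnj [of x "mat_cnj M *v x"] by (simp add: vec_cnj_mult)

lemma pos_def_mat_cnj: "pos_def M \<Longrightarrow> pos_def (mat_cnj M)"
  by (rule pos_defI) (simp_all add: mat_adj_mat_cnj pos_def_adj inner_mat_cnj pos_def_inner)

lemma pos_semidef_mat_cnj: "pos_semidef M \<Longrightarrow> pos_semidef (mat_cnj M)"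
  by (rule pos_semidefI)
    (simp_all add: mat_adj_mat_cnj pos_semidef_adj inner_mat_cnj pos_semidef_inner)

lemma pos_semidef_congruence': "pos_semidef M \<Longrightarrow> pos_semidef (T ** M ** mat_adj T)"
  using pos_semidef_congruence [of M "mat_adj T"] by simp

section \<open>The positive definite square root\<close>

text \<open>The real parts of the diagonal entries are the values of the form of \<open>M\<close> at
  the columns of \<open>T\<close>.\<close>

lemma trace_congruence_nonneg:
  assumes "pos_semidef M"
  shows "0 \<le> Re (trace (mat_adj T ** M ** T))"
proof -
  have "Re ((mat_adj T ** M ** T) $ i $ i) = inner (axis i 1) ((mat_adj T ** M ** T) *v axis i 1)" for i
    by (simp add: inner_axis' matrix_vector_mult_axis inner_complex_def)
  then show ?thesis
    by (simp add: trace_def inner_congruence sum_nonneg pos_semidef_inner assms)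
qed

text \<open>A vanishing sum of nonnegative terms has only zero terms; definiteness of
  \<open>M\<close> then makes every column of \<open>T\<close> vanish.\<close>

lemma trace_congruence_eq_0:
  assumes M: "pos_def M" and tr: "Re (trace (mat_adj T ** M ** T)) = 0"
  shows "T = 0"
proof -
  have eq: "Re ((mat_adj T ** M ** T) $ i $ i) = inner (T *v axis i 1) (M *v (T *v axis i 1))" for i
    unfolding inner_congruence [symmetric]
    by (simp add: inner_axis' matrix_vector_mult_axis inner_complex_def)
  have "inner (T *v axis i 1) (M *v (T *v axis i 1)) = 0" for i
    using tr pos_semidef_inner [OF pos_def_imp_semidef [OF M]]
    by (simp add: trace_def eq sum_nonneg_eq_0_iff)
  then have "T *v axis i 1 = 0" for i
    by (metis less_irrefl pos_def_inner [OF M])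
  then show ?thesis
    by (metis matrix_vector_mult_axis vec_eq_iff zero_index)
qed

text \<open>If \<open>S\<^sup>2 = S'\<^sup>2\<close> and \<open>D = S - S'\<close>, then \<open>D S + S' D = 0\<close>; multiplying by \<open>D\<close> and taking
  traces gives \<open>tr (D S D) + tr (D S' D) = 0\<close>.\<close>

lemma pos_def_sqrt_unique:
  assumes S: "pos_def S" and S': "pos_def S'" and eq: "S ** S = S' ** S'"
  shows "S = S'"
proof -
  define D where "D = S - S'"
  have D: "mat_adj D = D"
    by (simp add: D_def mat_adj_diff pos_def_adj S S')
  have "D ** S + S' ** D = 0"
    by (simp add: D_def matrix_distribs eq)
  then have "trace (D ** (D ** S + S' ** D)) = 0"
    by (simp add: trace_def)
  \<comment> \<open>Cyclicity brings \<open>D\<close> to both sides of \<open>S\<close>, producing a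
    congruence with nonnegative trace.\<close>
  moreover have "trace (D ** (D ** S)) = trace (D ** S ** D)"
    by (rule trace_mul_sym)
  ultimately have "trace (mat_adj D ** S ** D) + trace (mat_adj D ** S' ** D) = 0"
    by (simp add: D matrix_add_ldistrib trace_add matrix_mul_assoc)
  then have "Re (trace (mat_adj D ** S ** D)) + Re (trace (mat_adj D ** S' ** D)) = 0"
    by (metis plus_complex.sel(1) zero_complex.sel(1))
  then have "Re (trace (mat_adj D ** S ** D)) = 0"
    using trace_congruence_nonneg [OF pos_def_imp_semidef [OF S], of D]
      trace_congruence_nonneg [OF pos_def_imp_semidef [OF S'], of D] by linarith
  then have "D = 0"
    by (rule trace_congruence_eq_0 [OF S])
  then show ?thesis
    by (simp add: D_def)
qed

text \<open>Supplies boundedness for the fixed point argument below. Applying \<open>Z\<close> to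
  \<open>axis j 1\<close> bounds each entry by \<open>c\<close>, and a crude sum over the entries
  suffices.\<close>

lemma norm_matrix_le:
  fixes Z :: "complex ^ 'n ^ 'm"
  assumes "\<And>x. norm (Z *v x) \<le> c * norm x"
  shows "norm Z \<le> (\<Sum>i\<in>(UNIV :: 'm set). \<Sum>j\<in>(UNIV :: 'n set). c)"
proof -
  have le: "norm (Z $ i $ j) \<le> c" for i j
  proof -
    have "norm (Z $ i $ j) = norm ((Z *v axis j 1) $ i)"
      by (simp add: matrix_vector_mult_axis)
    also have "\<dots> \<le> norm (Z *v axis j 1)"
      by (rule Finite_Cartesian_Product.norm_nth_le)
    also have "\<dots> \<le> c"
      using assms [of "axis j 1"] by simp
    finally show ?thesis .
  qed
  have "norm Z \<le> (\<Sum>i\<in>UNIV. norm (Z $ i))"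
    unfolding norm_vec_def [of Z] by (rule L2_set_le_sum) simp
  also have "\<dots> \<le> (\<Sum>i\<in>UNIV. \<Sum>j\<in>UNIV. norm (Z $ i $ j))"
    by (intro sum_mono) (simp add: norm_vec_def L2_set_le_sum)
  also have "\<dots> \<le> (\<Sum>i\<in>(UNIV :: 'm set). \<Sum>j\<in>(UNIV :: 'n set). c)"
    by (intro sum_mono le)
  finally show ?thesis .
qed

text \<open>A fixed point \<open>Z\<close> of \<open>Z \<mapsto> (C + Z\<^sup>2) / 2\<close> satisfies \<open>(I - Z)\<^sup>2 = I - C\<close>. The map preserves
  the compact convex set of Hermitian matrices of operator norm at most \<open>c\<close>.\<close>

lemma sqrt_one_minus:
  fixes C :: "complex ^ 'n ^ 'n"
  assumes C: "mat_adj C = C" and c: "0 \<le> c" "c < 1"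
    and norm_C: "\<And>x. norm (C *v x) \<le> c * norm x"
  shows "\<exists>S. pos_def S \<and> S ** S = mat 1 - C"
proof -
  \<comment> \<open>As an intersection of closed conditions, \<open>K\<close> is closed term by
    term.\<close>
  define K :: "(complex ^ 'n ^ 'n) set"
    where "K = {Z. mat_adj Z = Z} \<inter> (\<Inter>x. {Z. norm (Z *v x) \<le> c * norm x})"
  define f where "f Z = (1/2) *\<^sub>R (C + Z ** Z)" for Z
  have cont_adj: "continuous_on UNIV (\<lambda>Z :: complex ^ 'n ^ 'n. mat_adj Z)"
    unfolding mat_adj_def mat_cnj_def map_matrix_def transpose_def
    by (intro continuous_intros)
  have cont_vec: "continuous_on UNIV (\<lambda>Z :: complex ^ 'n ^ 'n. norm (Z *v x))" for x
    unfolding matrix_vector_mult_def by (intro continuous_intros)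
  have "closed K"
    unfolding K_def
    by (intro closed_Int closed_INT ballI closed_Collect_eq closed_Collect_le
        cont_adj cont_vec continuous_intros)
  moreover have "bounded K"
    unfolding bounded_iff K_def using norm_matrix_le by blast
  ultimately have "compact K"
    by (simp add: compact_eq_bounded_closed)
  moreover have "convex K"
  proof (rule convexI)
    fix Y Z :: "complex ^ 'n ^ 'n" and u v :: real
    assume YZ: "Y \<in> K" "Z \<in> K" and uv: "0 \<le> u" "0 \<le> v" "u + v = 1"
    have "norm ((u *\<^sub>R Y + v *\<^sub>R Z) *v x) \<le> c * norm x" for x
    proof -
      have "norm ((u *\<^sub>R Y + v *\<^sub>R Z) *v x) \<le> u * norm (Y *v x) + v * norm (Z *v x)"
        using norm_triangle_ineq [of "u *\<^sub>R (Y *v x)" "v *\<^sub>R (Z *v x)"] uv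
        by (simp add: matrix_vector_mult_add_rdistrib scaleR_matrix_vector_gen)
      also have "\<dots> \<le> u * (c * norm x) + v * (c * norm x)"
        using YZ uv by (intro add_mono mult_left_mono) (auto simp: K_def)
      also have "\<dots> = c * norm x"
        using uv by (metis distrib_right mult_1)
      finally show ?thesis .
    qed
    then show "u *\<^sub>R Y + v *\<^sub>R Z \<in> K"
      using YZ by (simp add: K_def mat_adj_add mat_adj_scaleR)
  qed
  moreover have "K \<noteq> {}"
    using C norm_C by (auto simp: K_def)
  moreover have "continuous_on K f"
    unfolding f_def matrix_matrix_mult_def by (intro continuous_intros)
  moreover have "f \<in> K \<rightarrow> K"
  proof
    fix Z assume Z: "Z \<in> K"
    have "norm (f Z *v x) \<le> c * norm x" for x
    proof -
      \<comment> \<open>Since \<open>c < 1\<close>, the square of \<open>Z\<close> obeys the same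
        bound as \<open>Z\<close>, and so does its average with \<open>C\<close>.\<close>
      have "norm (Z *v (Z *v x)) \<le> c * norm (Z *v x)"
        using Z by (simp add: K_def)
      also have "\<dots> \<le> 1 * norm (Z *v x)"
        using c by (intro mult_right_mono) auto
      also have "\<dots> \<le> c * norm x"
        using Z by (simp add: K_def)
      finally have "norm (Z *v (Z *v x)) \<le> c * norm x" .
      moreover have "norm (f Z *v x) = norm (C *v x + Z *v (Z *v x)) / 2"
        by (simp add: f_def scaleR_matrix_vector_gen matrix_vector_mult_add_rdistrib
            matrix_vector_mul_assoc)
      ultimately show ?thesis
        using norm_triangle_ineq [of "C *v x" "Z *v (Z *v x)"] norm_C [of x] by linarith
    qed
    then show "f Z \<in> K"
      using Z C by (simp add: K_def f_def mat_adj_add mat_adj_scaleR mat_adj_mult)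
  qed
  ultimately obtain Z where Z: "Z \<in> K" and fix_pt: "f Z = Z"
    by (metis brouwer)
  have "pos_def (mat 1 - Z)"
  proof (rule pos_defI)
    show "mat_adj (mat 1 - Z) = mat 1 - Z"
      using Z by (simp add: K_def mat_adj_diff)
  next
    fix x :: "complex ^ 'n" assume "x \<noteq> 0"
    have "inner x (Z *v x) \<le> norm x * norm (Z *v x)"
      by (rule norm_cauchy_schwarz)
    also have "\<dots> \<le> norm x * (c * norm x)"
      using Z by (intro mult_left_mono) (auto simp: K_def)
    also have "\<dots> < norm x * norm x"
      using c \<open>x \<noteq> 0\<close> by simp
    finally show "0 < inner x ((mat 1 - Z) *v x)"
      by (simp add: matrix_vector_mult_diff_rdistrib inner_diff_right dot_square_norm power2_eq_square)
  qed
  moreover have "C + Z ** Z = 2 *\<^sub>R Z"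
    using arg_cong [OF fix_pt, of "scaleR 2"] by (simp add: f_def)
  then have "(mat 1 - Z) ** (mat 1 - Z) = mat 1 - C"
    by (simp add: matrix_distribs scaleR_2 algebra_simps)
  ultimately show ?thesis
    by blast
qed

text \<open>Rescaling reduces this to \<open>sqrt_one_minus\<close>: for a suitable \<open>s\<close>
  the matrix \<open>I - M/s\<close> is a strict contraction, and a root of \<open>M/s\<close> times
  \<open>sqrt s\<close> is a root of \<open>M\<close>.\<close>

lemma pos_def_sqrt_exists:
  fixes M :: "complex ^ 'n ^ 'n"
  assumes M: "pos_def M"
  shows "\<exists>S. pos_def S \<and> S ** S = M"
proof -
  have lin: "bounded_linear ((*v) M)"
    by (simp add: linear_conv_bounded_linear [symmetric])
  then obtain k where k: "k > 0" "\<And>x. norm (M *v x) \<le> norm x * k"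
    using bounded_linear.pos_bounded by blast
  obtain z :: "complex ^ 'n" where z: "norm z = 1"
    using vector_choose_size [of 1] by auto
  obtain x0 where x0: "norm x0 = 1" "\<And>x. norm x = 1 \<Longrightarrow> inner x0 (M *v x0) \<le> inner x (M *v x)"
  proof -
    have "continuous_on (sphere 0 1) (\<lambda>x. inner x (M *v x))"
      by (intro continuous_intros linear_continuous_on lin)
    then show ?thesis
      using continuous_attains_inf [of "sphere 0 1" "\<lambda>x. inner x (M *v x)"] z that
      by (auto simp: dist_norm)
  qed
  define m where "m = inner x0 (M *v x0)"
  have m: "0 < m"
    unfolding m_def using x0 by (intro pos_def_inner M) auto
  have lower: "m * (norm x)\<^sup>2 \<le> inner x (M *v x)" for x
  proof (cases "x = 0")
    case False
    then have "m \<le> inner (x /\<^sub>R norm x) (M *v (x /\<^sub>R norm x))"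
      unfolding m_def by (intro x0) simp
    also have "\<dots> = inner x (M *v x) / (norm x)\<^sup>2"
      by (simp add: matrix_vector_mult_scaleR_gen power2_eq_square divide_simps)
    finally show ?thesis
      using False by (simp add: field_simps)
  qed simp
  have "m \<le> inner z (M *v z)"
    using lower [of z] z by simp
  also have "\<dots> \<le> k"
    using norm_cauchy_schwarz [of z "M *v z"] k(2) [of z] z by simp
  finally have mk: "m \<le> k" .
  \<comment> \<open>On unit vectors the squared norm of \<open>(I - M/s) x\<close> is at most
    \<open>1 - 2m/s + k^2/s^2\<close>. This \<open>s\<close> minimises the bound, with value
    \<open>c^2\<close>; \<open>m \<le> k\<close> keeps the radicand nonnegative.\<close>
  define s where "s = k\<^sup>2 / m"
  define c where "c = sqrt (1 - m\<^sup>2 / k\<^sup>2)"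
  have s: "s > 0"
    using k m by (simp add: s_def)
  have c: "0 \<le> c" "c < 1" and c2: "c\<^sup>2 = 1 - m\<^sup>2 / k\<^sup>2"
    using k m mk power_mono [of m k 2] by (simp_all add: c_def)
  have "norm ((mat 1 - (1/s) *\<^sub>R M) *v x) \<le> c * norm x" for x
  proof (rule power2_le_imp_le)
    have "(norm ((mat 1 - (1/s) *\<^sub>R M) *v x))\<^sup>2
        = (norm x)\<^sup>2 - 2 / s * inner x (M *v x) + (norm (M *v x))\<^sup>2 / s\<^sup>2"
      unfolding power2_norm_eq_inner
      by (simp add: matrix_vector_mult_diff_rdistrib scaleR_matrix_vector_gen
          inner_diff_left inner_diff_right inner_commute power2_eq_square)
    also have "\<dots> \<le> (norm x)\<^sup>2 - 2 / s * (m * (norm x)\<^sup>2) + (norm x * k)\<^sup>2 / s\<^sup>2"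
      using s by (intro add_mono diff_mono mult_left_mono divide_right_mono power_mono lower k) auto
    also have "\<dots> = (c * norm x)\<^sup>2"
      unfolding power_mult_distrib c2 s_def using k m by (simp add: field_simps power2_eq_square)
    finally show "(norm ((mat 1 - (1/s) *\<^sub>R M) *v x))\<^sup>2 \<le> (c * norm x)\<^sup>2" .
  qed (use c in simp)
  then obtain S where S: "pos_def S" "S ** S = mat 1 - (mat 1 - (1/s) *\<^sub>R M)"
    using sqrt_one_minus [of "mat 1 - (1/s) *\<^sub>R M" c] c M
    by (auto simp: mat_adj_diff mat_adj_scaleR pos_def_adj)
  have "pos_def (sqrt s *\<^sub>R S)"
    using S(1) s
    by (intro pos_defI)
      (simp_all add: mat_adj_scaleR pos_def_adj scaleR_matrix_vector_gen pos_def_inner)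
  moreover have "(sqrt s *\<^sub>R S) ** (sqrt s *\<^sub>R S) = M"
    using S(2) s by (simp add: scalar_matrix_assoc [symmetric] matrix_scalar_ac)
  ultimately show ?thesis
    by blast
qed

text \<open>Existence and uniqueness together justify the \<open>THE\<close> in the
  definition.\<close>

lemma pd_sqrt:
  assumes "pos_def M"
  shows "pos_def (pd_sqrt M)" "pd_sqrt M ** pd_sqrt M = M"
proof -
  obtain S where S: "pos_def S \<and> S ** S = M"
    using pos_def_sqrt_exists [OF assms] by blast
  then have "pd_sqrt M = S"
    unfolding pd_sqrt_def by (rule the_equality) (rule pos_def_sqrt_unique, use S in simp_all)
  then show "pos_def (pd_sqrt M)" "pd_sqrt M ** pd_sqrt M = M"
    using S by simp_all
qed

lemma pd_inv_sqrt:
  assumes "pos_def M"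
  shows "pos_def (pd_inv_sqrt M)" "pd_inv_sqrt M ** M ** pd_inv_sqrt M = mat 1"
proof -
  note inv = pos_def_invertible [OF pd_sqrt(1) [OF assms]]
  show "pos_def (pd_inv_sqrt M)"
    unfolding pd_inv_sqrt_def by (intro pos_def_matrix_inv pd_sqrt assms)
  have "pd_inv_sqrt M ** M = pd_inv_sqrt M ** (pd_sqrt M ** pd_sqrt M)"
    by (simp add: pd_sqrt assms)
  then show "pd_inv_sqrt M ** M ** pd_inv_sqrt M = mat 1"
    by (simp add: pd_inv_sqrt_def matrix_mul_assoc matrix_inv_left matrix_inv_right inv)
qed

section \<open>A criterion for maximality\<close>

text \<open>Take \<open>x\<close> minimising \<open>x\<^sup>H D x / x\<^sup>H M x\<close>, with minimum \<open>\<mu>\<close>. If \<open>\<mu> < 0\<close>, then at \<open>y = (T x)\<^sup>#\<close>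
  we would have \<open>x\<^sup>H D x \<ge> y\<^sup>H D y \<ge> \<mu> y\<^sup>H M y > \<mu> x\<^sup>H M x\<close>.\<close>

lemma pos_semidef_of_antilinear_stein:
  fixes D M T :: "complex ^ 'n ^ 'n"
  assumes D: "mat_adj D = D" and M: "pos_def M"
    and stein_M: "pos_def (M - mat_adj T ** mat_cnj M ** T)"
    and stein_D: "pos_semidef (D - mat_adj T ** mat_cnj D ** T)"
  shows "pos_semidef D"
proof (rule pos_semidefI)
  have lin: "bounded_linear ((*v) N)" for N :: "complex ^ 'n ^ 'n"
    by (simp add: linear_conv_bounded_linear [symmetric])
  define q where "q N x = inner x (N *v x)" for N :: "complex ^ 'n ^ 'n" and x
  have q_scale: "q N (r *\<^sub>R x) = r\<^sup>2 * q N x" for N r x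
    by (simp add: q_def matrix_vector_mult_scaleR_gen power2_eq_square)
  have q_pos: "0 < q M x" if "x \<noteq> 0" for x
    using pos_def_inner [OF M that] by (simp add: q_def)
  \<comment> \<open>The conjugate on \<open>N\<close> moves to the vector, which explains the test
    vector \<open>y\<close> below.\<close>
  have q_T: "q (mat_adj T ** mat_cnj N ** T) x = q N (vec_cnj (T *v x))" for N x
    by (simp add: q_def inner_congruence inner_mat_cnj)
  have q_diff: "q (N - N') x = q N x - q N' x" for N N' x
    by (simp add: q_def matrix_vector_mult_diff_rdistrib inner_diff_right)
  have "q M x \<noteq> 0" if "x \<in> sphere 0 1" for x
    using q_pos [of x] that by force
  then have "continuous_on (sphere 0 1) (\<lambda>x. q D x / q M x)"
    unfolding q_def by (intro continuous_intros linear_continuous_on lin) auto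
  moreover have "sphere (0 :: complex ^ 'n) 1 \<noteq> {}"
    by simp
  ultimately obtain x0 :: "complex ^ 'n" where x0: "norm x0 = 1"
    and min: "\<And>x. norm x = 1 \<Longrightarrow> q D x0 / q M x0 \<le> q D x / q M x"
    using continuous_attains_inf [of "sphere (0 :: complex ^ 'n) 1" "\<lambda>x. q D x / q M x"]
    by (auto simp: dist_norm)
  define \<mu> where "\<mu> = q D x0 / q M x0"
  have ge: "\<mu> * q M x \<le> q D x" for x
  proof (cases "x = 0")
    case False
    have "\<mu> \<le> q D (x /\<^sub>R norm x) / q M (x /\<^sub>R norm x)"
      unfolding \<mu>_def using False by (intro min) simp
    also have "\<dots> = q D x / q M x"
      using False by (simp add: q_scale)
    finally show ?thesis
      using q_pos [OF False] by (simp add: field_simps)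
  qed (simp add: q_def)
  have "x0 \<noteq> 0"
    using x0 by auto
  have "\<mu> \<ge> 0"
  proof (rule ccontr)
    assume "\<not> \<mu> \<ge> 0"
    define y where "y = vec_cnj (T *v x0)"
    have "q M y < q M x0"
      using pos_def_inner [OF stein_M \<open>x0 \<noteq> 0\<close>] by (simp add: q_def [symmetric] q_diff q_T y_def)
    then have "\<mu> * q M x0 < \<mu> * q M y"
      using \<open>\<not> \<mu> \<ge> 0\<close> by simp
    also have "\<dots> \<le> q D y"
      by (rule ge)
    also have "\<dots> \<le> q D x0"
      using pos_semidef_inner [OF stein_D, of x0] by (simp add: q_def [symmetric] q_diff q_T y_def)
    also have "\<dots> = \<mu> * q M x0"
      using q_pos [OF \<open>x0 \<noteq> 0\<close>] by (simp add: \<mu>_def)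
    finally show False
      by simp
  qed
  show "0 \<le> inner x (D *v x)" for x
    using order_trans [OF mult_nonneg_nonneg [OF \<open>\<mu> \<ge> 0\<close>] ge [of x]]
      pos_semidef_inner [OF pos_def_imp_semidef [OF M], of x]
    by (simp add: q_def)
qed (rule D)

text \<open>Here \<open>M\<close> certifies that \<open>T\<close> is an antilinear contraction. For
  a competing solution \<open>Y\<close>, subtracting the equations gives
  \<open>D = A^H (Y^-# - X^-#) A\<close>, which is \<open>T^H D^# T\<close> plus a semidefinite
  remainder.\<close>

lemma nme_maximalI:
  fixes A X M :: "complex ^ 'n ^ 'n"
  assumes X: "nme_pd_solution A X" and M: "pos_def M"
    and T: "T = mat_cnj (matrix_inv X) ** A"
    and stein: "pos_def (M - mat_adj T ** mat_cnj M ** T)"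
  shows "nme_maximal_solution A X"
  unfolding nme_maximal_solution_def loewner_le_def
proof (intro conjI allI impI)
  fix Y assume Y: "nme_pd_solution A Y"
  define D Xi Yi where "D = X - Y" and "Xi = matrix_inv X" and "Yi = matrix_inv Y"
  have pd: "pos_def X" "pos_def Y"
    using X Y by (auto simp: nme_pd_solution_def)
  note inv = pd [THEN pos_def_invertible]
  have D: "mat_adj D = D"
    by (simp add: D_def mat_adj_diff pos_def_adj pd)
  have Xi: "mat_adj Xi = Xi"
    by (simp add: Xi_def pos_def_adj pos_def_matrix_inv pd)
  have canc: "Xi ** X = mat 1" "Y ** Yi = mat 1" "X ** Xi = mat 1" "Yi ** Y = mat 1"
    "N ** X ** Xi = N" "N ** Xi ** X = N" "N ** Y ** Yi = N" "N ** Yi ** Y = N"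
    for N :: "complex ^ 'n ^ 'n"
    by (simp_all add: Xi_def Yi_def inv matrix_inv_left matrix_inv_right matrix_inv_cancel)
  have res: "Xi ** D ** Yi = Yi - Xi" "Yi ** D ** Xi = Yi - Xi"
    by (simp_all add: D_def matrix_distribs canc)
  \<comment> \<open>The resolvent identity used twice leaves a term linear in \<open>D\<close> and a
    quadratic one that is a congruence of \<open>Yi\<close>.\<close>
  have "Yi - Xi = Xi ** D ** Xi + Xi ** D ** Yi ** D ** Xi"
    by (simp add: res matrix_distribs)
  then have diff: "mat_cnj Yi - mat_cnj Xi
      = mat_cnj (Xi ** D ** Xi) + mat_cnj (Xi ** D ** Yi ** D ** Xi)"
    by (simp only: mat_cnj_add [symmetric] mat_cnj_diff [symmetric])
  have "D = mat_adj A ** (mat_cnj Yi - mat_cnj Xi) ** A"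
    using X Y by (simp add: nme_pd_solution_def D_def Xi_def Yi_def matrix_distribs algebra_simps)
  also have "\<dots> = mat_adj T ** mat_cnj D ** T
      + mat_adj (mat_cnj D ** T) ** mat_cnj Yi ** (mat_cnj D ** T)"
    unfolding diff
    by (simp add: T Xi_def [symmetric] mat_cnj_mult mat_adj_mult mat_adj_mat_cnj D Xi
        matrix_distribs matrix_mul_assoc)
  finally have "D - mat_adj T ** mat_cnj D ** T
      = mat_adj (mat_cnj D ** T) ** mat_cnj Yi ** (mat_cnj D ** T)"
    by (simp add: algebra_simps)
  moreover have "pos_semidef (mat_adj (mat_cnj D ** T) ** mat_cnj Yi ** (mat_cnj D ** T))"
    unfolding Yi_def
    by (intro pos_semidef_congruence pos_def_imp_semidef pos_def_mat_cnj pos_def_matrix_inv pd)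
  ultimately have "pos_semidef D"
    using pos_semidef_of_antilinear_stein [OF D M stein] by simp
  then show "pos_semidef (X - Y)"
    by (simp add: D_def)
qed (rule X)

section \<open>From the anti-Riccati equation to the nonlinear matrix equation\<close>

theorem proposition1:
  fixes A2 Q Q0 A :: "complex ^ 'n ^ 'n"
    and B2 :: "complex ^ 'm ^ 'n"
    and R :: "complex ^ 'm ^ 'm"
  assumes "pos_def Q" and "pos_def R"
    and "Q0 = matrix_inv Q
              + mat_cnj (A2 ** matrix_inv Q ** mat_adj A2)
              + mat_cnj (B2 ** matrix_inv R ** mat_adj B2)"
    and "A = mat_cnj (pd_inv_sqrt Q0) ** A2 ** matrix_inv Q ** pd_inv_sqrt Q0"
  shows "pos_def Q0 \<and>
    (\<forall>P. pos_def P \<and> anti_riccati A2 B2 Q R P \<longrightarrow>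
      (\<exists>X. nme_pd_solution A X \<and>
           X = pd_inv_sqrt Q0
               ** (matrix_inv P
                   + mat_cnj (A2 ** matrix_inv Q ** mat_adj A2)
                   + mat_cnj (B2 ** matrix_inv R ** mat_adj B2))
               ** pd_inv_sqrt Q0 \<and>
           (stabilizable A2 B2 \<longrightarrow> nme_maximal_solution A X)))"
proof (intro conjI allI impI)
  note Q = assms(1) and R = assms(2)
  define G F where "G = B2 ** matrix_inv R ** mat_adj B2" and "F = A2 ** matrix_inv Q ** mat_adj A2"
  have G: "pos_semidef G" and F: "pos_semidef F"
    unfolding G_def F_def
    by (intro pos_semidef_congruence' pos_def_imp_semidef pos_def_matrix_inv Q R)+
  \<comment> \<open>Both \<open>Q0\<close> and \<open>W\<close> have this shape, with
    \<open>N = Q\<close> and \<open>N = P\<close>.\<close>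
  have pd: "pos_def (matrix_inv N + mat_cnj F + mat_cnj G)" if "pos_def N" for N
    by (intro pos_def_add_semidef pos_semidef_mat_cnj pos_def_matrix_inv F G that)
  have Q0: "Q0 = matrix_inv Q + mat_cnj F + mat_cnj G"
    by (simp add: assms(3) F_def G_def)
  show pd_Q0: "pos_def Q0"
    unfolding Q0 by (rule pd [OF Q])
  fix P assume asm: "pos_def P \<and> anti_riccati A2 B2 Q R P"
  then have P: "pos_def P" and riccati: "anti_riccati A2 B2 Q R P"
    by auto
  define S where "S = pd_inv_sqrt Q0"
  define W where "W = matrix_inv P + mat_cnj F + mat_cnj G"
  define X where "X = S ** W ** S"
  define K where "K = matrix_inv (mat_cnj P) + G"
  define L where "L = A2 ** matrix_inv Q"
  define Wi where "Wi = mat_cnj (matrix_inv W)"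
  define T where "T = Wi ** L"
  have S: "pos_def S" "S ** Q0 ** S = mat 1"
    unfolding S_def by (rule pd_inv_sqrt [OF pd_Q0])+
  have W: "pos_def W"
    unfolding W_def by (rule pd [OF P])
  have K: "pos_def K"
    unfolding K_def by (intro pos_def_add_semidef G pos_def_matrix_inv pos_def_mat_cnj P)
  have inv: "invertible P" "invertible Q" "invertible R" "invertible S" "invertible W" "invertible K"
    by (intro pos_def_invertible P Q R S W K)+
  note adj = P [THEN pos_def_adj] Q [THEN pos_def_adj] S(1) [THEN pos_def_adj]
    W [THEN pos_def_adj] K [THEN pos_def_adj] pos_semidef_adj [OF G]
  have Wcnj: "mat_cnj W = K + A2 ** matrix_inv Q ** mat_adj A2"
    by (simp add: W_def K_def F_def mat_cnj_add matrix_inv_mat_cnj inv)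
  have Wi: "Wi = matrix_inv (mat_cnj W)"
    by (simp add: Wi_def matrix_inv_mat_cnj inv)

  have U: "invertible (R + mat_adj B2 ** mat_cnj P ** B2)"
    by (intro pos_def_invertible pos_def_add_semidef pos_semidef_congruence pos_def_imp_semidef
        pos_def_mat_cnj P R)
  \<comment> \<open>First use of Woodbury, at \<open>P^#\<close>: between \<open>A2^H\<close> and
    \<open>A2\<close>, the inverse of \<open>K\<close> is the nonlinear part of the anti-Riccati
    equation.\<close>
  have "K ** (mat_cnj P - mat_cnj P ** B2 ** matrix_inv (R + mat_adj B2 ** mat_cnj P ** B2)
      ** mat_adj B2 ** mat_cnj P) = mat 1"
    unfolding K_def G_def
    by (intro woodbury matrix_inv_mat_cnj inv U)
  then have "matrix_inv K = mat_cnj P - mat_cnj P ** B2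
      ** matrix_inv (R + mat_adj B2 ** mat_cnj P ** B2) ** mat_adj B2 ** mat_cnj P"
    by (rule matrix_inv_unique)
  then have K_eq: "mat_adj A2 ** matrix_inv K ** A2 = P - Q"
    using riccati unfolding anti_riccati_def
    by (simp only: matrix_distribs matrix_mul_assoc) (simp add: algebra_simps)
  then have P_eq: "P = Q + mat_adj A2 ** matrix_inv K ** A2"
    by simp

  \<comment> \<open>Second use, at \<open>Q^-1\<close> with \<open>K\<close> in the place of
    \<open>R\<close>: the matrix inverted inside is now \<open>W^#\<close>.\<close>
  have "(matrix_inv (matrix_inv Q) + mat_adj A2 ** matrix_inv K ** A2)
      ** (matrix_inv Q - matrix_inv Q ** mat_adj A2 ** matrix_inv (K + A2 ** matrix_inv Q ** mat_adj A2)
        ** A2 ** matrix_inv Q) = mat 1"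
    by (intro woodbury matrix_inv_invertible inv)
      (simp add: Wcnj [symmetric] matrix_inv_mat_cnj inv)
  then have "P ** (matrix_inv Q - matrix_inv Q ** mat_adj A2 ** Wi ** A2 ** matrix_inv Q) = mat 1"
    by (simp add: P_eq [symmetric] matrix_inv_invertible inv Wi Wcnj)
  then have "matrix_inv P = matrix_inv Q - matrix_inv Q ** mat_adj A2 ** Wi ** A2 ** matrix_inv Q"
    by (rule matrix_inv_unique)
  then have W_eq: "W + mat_adj L ** Wi ** L = Q0"
    by (simp add: W_def Q0 L_def mat_adj_mult mat_adj_matrix_inv inv adj matrix_mul_assoc)

  have A: "A = mat_cnj S ** L ** S"
    by (simp add: assms(4) S_def L_def matrix_mul_assoc)
  have X_inv: "mat_cnj (matrix_inv X) = mat_cnj (matrix_inv S) ** Wi ** mat_cnj (matrix_inv S)"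
    by (simp add: X_def Wi_def matrix_inv_mult inv invertible_mult mat_cnj_mult matrix_mul_assoc)
  have canc: "N ** mat_cnj S ** mat_cnj (matrix_inv S) = N"
      "N ** mat_cnj (matrix_inv S) ** mat_cnj S = N" for N :: "complex ^ 'n ^ 'n"
    using matrix_inv_cancel [OF matrix_inv_mat_cnj(2) [OF inv(4)], of N]
    by (simp_all add: matrix_inv_mat_cnj inv)
  \<comment> \<open>The inner factors \<open>S^#\<close> of \<open>A\<close> and its adjoint cancel
    against those of \<open>X^-#\<close>, leaving one congruence by \<open>S\<close>.\<close>
  have "X + mat_adj A ** mat_cnj (matrix_inv X) ** A = S ** (W + mat_adj L ** Wi ** L) ** S"
    unfolding X_inv
    by (simp add: X_def A mat_adj_mult mat_adj_mat_cnj adj matrix_distribs matrix_mul_assoc canc)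
  also have "\<dots> = mat 1"
    by (simp add: W_eq S)
  finally have nme: "nme_pd_solution A X"
    using pos_def_congruence [OF W inv(4)] by (simp add: nme_pd_solution_def X_def adj)

  \<comment> \<open>A second formula for \<open>T\<close>:
    \<open>W^# K^-1 A2 = A2 + A2 Q^-1 A2^H K^-1 A2 = A2 Q^-1 P\<close>.\<close>
  have "mat_cnj W ** (matrix_inv K ** A2 ** matrix_inv P) = A2 ** matrix_inv Q
      ** (Q + mat_adj A2 ** matrix_inv K ** A2) ** matrix_inv P"
    by (simp add: Wcnj matrix_distribs matrix_mul_assoc matrix_inv_cancel matrix_inv_right inv)
  also have "\<dots> = L"
    by (simp add: P_eq [symmetric] matrix_inv_cancel inv L_def)
  finally have "Wi ** (mat_cnj W ** (matrix_inv K ** A2 ** matrix_inv P)) = T"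
    by (simp add: T_def)
  moreover have "Wi ** mat_cnj W = mat 1"
    by (simp add: Wi matrix_inv_left matrix_inv_mat_cnj(2) inv)
  ultimately have T: "T = matrix_inv K ** A2 ** matrix_inv P"
    by (simp add: matrix_mul_assoc)
  have K_G: "mat_cnj (matrix_inv P) = K - G"
    by (simp add: K_def matrix_inv_mat_cnj inv)
  \<comment> \<open>Replacing \<open>P^-#\<close> by \<open>K - G\<close> turns the Stein difference
    of \<open>P^-1\<close> into \<open>P^-1 Q P^-1 + T^H G T\<close>, where the first term is
    definite.\<close>
  have "mat_adj T ** K ** T = matrix_inv P ** (mat_adj A2 ** matrix_inv K ** A2) ** matrix_inv P"
    by (simp add: T mat_adj_mult mat_adj_matrix_inv inv adj matrix_mul_assoc matrix_inv_cancel)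
  also have "mat_adj A2 ** matrix_inv K ** A2 = P - Q"
    by (simp add: K_eq)
  also have "matrix_inv P ** (P - Q) ** matrix_inv P
      = matrix_inv P - matrix_inv P ** Q ** matrix_inv P"
    by (simp add: matrix_distribs matrix_inv_left inv)
  finally have stein: "matrix_inv P - mat_adj T ** mat_cnj (matrix_inv P) ** T
      = mat_adj (matrix_inv P) ** Q ** matrix_inv P + mat_adj T ** G ** T"
    by (simp add: K_G matrix_distribs mat_adj_matrix_inv inv adj)
  have stein_pd: "pos_def (matrix_inv P - mat_adj T ** mat_cnj (matrix_inv P) ** T)"
    unfolding stein
    by (intro pos_def_add_semidef pos_def_congruence pos_semidef_congruence Q G
        matrix_inv_invertible inv)

  \<comment> \<open>Congruence by \<open>S\<close> carries the certificate \<open>P^-1\<close> for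
    \<open>T\<close> to one for \<open>T'\<close>, which is the matrix required by
    \<open>nme_maximalI\<close>.\<close>
  define M where "M = S ** matrix_inv P ** S"
  define T' where "T' = mat_cnj (matrix_inv X) ** A"
  have T': "T' = mat_cnj (matrix_inv S) ** T ** S"
    by (simp add: T'_def T_def X_inv A matrix_mul_assoc canc)
  have "M - mat_adj T' ** mat_cnj M ** T'
      = mat_adj S ** (matrix_inv P - mat_adj T ** mat_cnj (matrix_inv P) ** T) ** S"
    by (simp add: M_def T' mat_cnj_mult mat_adj_mult mat_adj_mat_cnj mat_adj_matrix_inv inv adj
        matrix_distribs matrix_mul_assoc canc)
  then have "pos_def (M - mat_adj T' ** mat_cnj M ** T')"
    using pos_def_congruence [OF stein_pd inv(4)] by simp
  moreover have "pos_def M"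
    using pos_def_congruence [OF pos_def_matrix_inv [OF P] inv(4)] by (simp add: M_def adj)
  ultimately have "nme_maximal_solution A X"
    using nme_maximalI [OF nme] T'_def by blast
  then show "\<exists>X. nme_pd_solution A X \<and>
           X = pd_inv_sqrt Q0
               ** (matrix_inv P
                   + mat_cnj (A2 ** matrix_inv Q ** mat_adj A2)
                   + mat_cnj (B2 ** matrix_inv R ** mat_adj B2))
               ** pd_inv_sqrt Q0 \<and>
           (stabilizable A2 B2 \<longrightarrow> nme_maximal_solution A X)"
    using nme by (intro exI [of _ X]) (simp add: X_def W_def S_def F_def G_def)
qed

end
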